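(* Let $X$ and $Y$ be locally compact and separable metric spaces. Let $\pi: X \to Y$ be a Borel map, let $\mu \in \mathcal{M}_{+}(X)$, and define $\nu = \pi_{*}\mu \in \mathcal{M}_{+}(Y)$. Then there exist measures $\mu_{y} \in \mathcal{M}_{+}(X)$, $y \in Y$, such that: (1) $y \mapsto \mu_{y}$ is a Borel map and $\mu_{y} \in \mathscr{P}(X)$ for $\nu$-almost every $y \in Y$; (2) $\mu = \nu \otimes \mu_{y}$, that is, $\mu(A)= \int_{Y} \mu_{y}(A)\, d\nu(y)$ for every $A \in \mathcal{B}(X)$; (3) $\mu_{y}$ is concentrated on $\pi^{-1}(y)$ for $\nu$-almost every $y \in Y$.
   Context: $\mathcal{M}_{+}(X)$ denotes the set of all positive and finite Radon measures on $X$; $\mathscr{P}(X)$ the set of Borel probability measures on $X$; $\mathcal{B}(X)$ the Borel $\sigma$-algebra of $X$. The push-forward is $\pi_*\mu(B)=\mu(\pi^{-1}(B))$. A measure-valued map $y\mapsto\mu_y$ is Borel if $y\mapsto \mu_y(A)$ is Borel measurable for every $A\in\mathcal{B}(X)$. A measure is concentrated on a set if the complement of that set has measure zero. *)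

theory Defs
  imports "HOL-Probability.Probability"
begin

text \<open>Inner regularity by compact sets is part of the notion of a Radon measure; finiteness on
  compact sets is subsumed by finiteness of the measure.\<close>

definition finite_radon_measures :: "'a::metric_space measure set" where
  "finite_radon_measures =
     {M. sets M = sets borel \<and> finite_measure M \<and>
         (\<forall>A\<in>sets borel. emeasure M A = (SUP K\<in>{K. compact K \<and> K \<subseteq> A}. emeasure M K))}"

definition borel_measure_map ::
    "('b::topological_space \<Rightarrow> 'a::topological_space measure) \<Rightarrow> bool" where
  "borel_measure_map \<mu> \<longleftrightarrow>
     (\<forall>A\<in>sets (borel :: 'a measure). (\<lambda>y. emeasure (\<mu> y) A) \<in> borel_measurable borel)"

text \<open>Membership in \<^const>\<open>null_sets\<close> rather than \<open>emeasure M (space M - S) = 0\<close>, since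
  \<^const>\<open>emeasure\<close> takes the value 0 on every non-measurable set.\<close>

definition concentrated_on :: "'a measure \<Rightarrow> 'a set \<Rightarrow> bool" where
  "concentrated_on M S \<longleftrightarrow> space M - S \<in> null_sets M"

end

theory Submission
  imports Defs
begin

text \<open>For each Borel set \<open>A\<close>, the Radon--Nikodym density \<open>g A\<close> of \<open>B \<mapsto> \<mu>(A \<inter> \<pi>\<^sup>-\<^sup>1(B))\<close> with respect to
  \<open>\<nu>\<close> is the candidate for \<open>y \<mapsto> \<mu>\<^sub>y(A)\<close>. Finite additivity of \<open>A \<mapsto> g A y\<close> holds for almost every
  \<open>y\<close> on a given countable algebra. Countable additivity comes from a compact class: \<open>\<mu>\<close> is inner
  regular, so every set of a countable algebra \<open>\<A>\<close> generating the Borel sets is exhausted by countably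
  many compact sets, which are put into a larger countable algebra \<open>\<B>\<close>. For almost every \<open>y\<close> the
  content \<open>g \<cdot> y\<close> is additive on \<open>\<B>\<close> and approximable by these compact sets on \<open>\<A>\<close>, hence extends by
  Caratheodory's theorem to a Borel measure. Concentration on the fibre over \<open>y\<close> follows by testing
  against preimages of a countable base of \<open>Y\<close>.\<close>

subsection \<open>Compact inner regularity\<close>

text \<open>Separability enters as a hypothesis on a metric space type rather than through a type
  class, so the countable basis is built explicitly: balls of radius 1/(n+1) around the points of a
  countable dense set.\<close>

lemma separable_metric_countable_basis:
  assumes "separable_space (euclidean :: 'a::metric_space topology)"
  obtains \<B> :: "'a::metric_space set set" where "countable \<B>" "topological_basis \<B>"
proof -
  obtain C :: "'a set" where C: "countable C" "closure C = UNIV"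
    using assms by (auto simp: separable_space_def)
  define \<B> where "\<B> = (\<lambda>(c, n). ball c (inverse (real (Suc n)))) ` (C \<times> (UNIV :: nat set))"
  have "countable \<B>"
    unfolding \<B>_def using C by auto
  moreover have "topological_basis \<B>"
  proof (rule topological_basisI)
    show "open B" if "B \<in> \<B>" for B
      using that by (auto simp: \<B>_def)
  next
    fix U and x :: 'a
    assume "open U" "x \<in> U"
    then obtain e where e: "0 < e" "ball x e \<subseteq> U"
      by (meson openE)
    obtain n where n: "inverse (real (Suc n)) < e / 2"
      using reals_Archimedean[of "e / 2"] e by auto
    obtain c where c: "c \<in> C" "dist c x < inverse (real (Suc n))"
      using C(2) closure_approachable[of x C] by (metis UNIV_I inverse_positive_iff_positive of_nat_0_less_iff zero_less_Suc)
    have "ball c (inverse (real (Suc n))) \<subseteq> ball x e"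
    proof
      fix z assume "z \<in> ball c (inverse (real (Suc n)))"
      then have "dist x z < e"
        using dist_triangle[of x z c] c n by (simp add: dist_commute)
      then show "z \<in> ball x e" by simp
    qed
    then have "ball c (inverse (real (Suc n))) \<in> \<B> \<and> x \<in> ball c (inverse (real (Suc n))) \<and>
        ball c (inverse (real (Suc n))) \<subseteq> U"
      using c e by (auto simp: \<B>_def)
    then show "\<exists>B\<in>\<B>. x \<in> B \<and> B \<subseteq> U" by blast
  qed
  ultimately show thesis by (rule that)
qed

text \<open>Every point of \<open>U\<close> lies in a basis set that is trapped inside some compact
  subset of \<open>U\<close>. There are only countably many basis sets, so choosing one compact set
  for each trapped basis set exhausts \<open>U\<close>.\<close>

lemma open_eq_countable_Union_compact:
  fixes U :: "'a::metric_space set"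
  assumes lc: "locally_compact_space (euclidean :: 'a topology)"
    and sep: "separable_space (euclidean :: 'a topology)"
    and U: "open U"
  obtains K :: "nat \<Rightarrow> 'a set" where "\<And>n. compact (K n)" "U = (\<Union>n. K n)"
proof -
  obtain \<B> :: "'a set set" where \<B>: "countable \<B>" "topological_basis \<B>"
    using separable_metric_countable_basis[OF sep] .
  define \<V> where "\<V> = {V \<in> \<B>. \<exists>K. compact K \<and> V \<subseteq> K \<and> K \<subseteq> U}"
  have "\<forall>V\<in>\<V>. \<exists>K. compact K \<and> V \<subseteq> K \<and> K \<subseteq> U" by (simp add: \<V>_def)
  then obtain k where k: "\<And>V. V \<in> \<V> \<Longrightarrow> compact (k V) \<and> V \<subseteq> k V \<and> k V \<subseteq> U"
    by metis
  have cover: "\<exists>V\<in>\<V>. x \<in> V" if x: "x \<in> U" for x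
  proof -
    obtain W K where W: "open W" "compact K" "x \<in> W" "W \<subseteq> K"
      using lc unfolding locally_compact_space_def by (auto simp del: ex_simps) blast
    obtain e where e: "0 < e" "cball x e \<subseteq> U"
      using open_contains_cball_eq[OF U] x by auto
    obtain V where V: "V \<in> \<B>" "x \<in> V" "V \<subseteq> ball x e \<inter> W"
      using topological_basisE[OF \<B>(2), of "ball x e \<inter> W" x] W e by (auto simp: open_Int)
    \<comment> \<open>Closed balls of a metric space need not be compact; intersecting with the
      compact neighbourhood \<open>K\<close> of \<open>x\<close> yields a compact set between
      \<open>V\<close> and \<open>U\<close>.\<close>
    have "compact (K \<inter> cball x e)" "V \<subseteq> K \<inter> cball x e" "K \<inter> cball x e \<subseteq> U"
      using W V e by (auto intro: compact_Int_closed)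
    then show ?thesis using V(1,2) unfolding \<V>_def by blast
  qed
  have "countable (k ` \<V>)"
    using \<B>(1) by (auto simp: \<V>_def)
  \<comment> \<open>Adding the empty set makes the countable family nonempty, so that it is the
    range of a sequence; the union does not change.\<close>
  define K where "K = from_nat_into (insert {} (k ` \<V>))"
  have K: "range K = insert {} (k ` \<V>)"
    unfolding K_def by (rule range_from_nat_into) (use \<open>countable (k ` \<V>)\<close> in auto)
  show thesis
  proof
    show "compact (K n)" for n
      using rangeI[of K n] k unfolding K by auto
    have "(\<Union>n. K n) = \<Union> (k ` \<V>)" unfolding K by auto
    also have "\<dots> = U"
    proof (intro equalityI subsetI)
      show "x \<in> U" if "x \<in> \<Union> (k ` \<V>)" for x using that k by fastforce
      show "x \<in> \<Union> (k ` \<V>)" if "x \<in> U" for x using cover[OF that] k by fastforce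
    qed
    finally show "U = (\<Union>n. K n)" by simp
  qed
qed

text \<open>The remainders decrease to the empty set, so continuity from above applies. This
  truncates a countable union of compact sets, which need not be compact, to a finite one, which
  is.\<close>

lemma (in finite_measure) measure_diff_finite_Union:
  fixes A :: "nat \<Rightarrow> 'a set"
  assumes "range A \<subseteq> sets M" "0 < e"
  obtains n where "measure M ((\<Union>i. A i) - (\<Union>i<n. A i)) < (e::real)"
proof -
  define D where "D n = (\<Union>i. A i) - (\<Union>i<n. A i)" for n :: nat
  have "(\<lambda>n. measure M (D n)) \<longlonglongrightarrow> measure M (\<Inter>n. D n)"
  proof (rule finite_Lim_measure_decseq)
    show "range D \<subseteq> sets M" using assms by (auto simp: D_def)
    show "decseq D" by (auto simp: D_def decseq_def)
  qed
  moreover have "(\<Inter>n. D n) = {}" by (auto simp: D_def)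
  ultimately have "(\<lambda>n. measure M (D n)) \<longlonglongrightarrow> 0" by simp
  then have "eventually (\<lambda>n. measure M (D n) < e) sequentially"
    using assms(2) by (rule order_tendstoD)
  then show thesis using that by (auto simp: eventually_sequentially D_def)
qed

lemma (in finite_measure) measure_Union_geometric:
  assumes "range A \<subseteq> sets M" "\<And>i. measure M (A i) \<le> (e::real) * (1 / 2) ^ Suc i"
  shows "measure M (\<Union>i. A i) \<le> e"
proof -
  have s: "(\<lambda>i. e * (1 / 2) ^ Suc i) sums (e * 1)"
    using power_half_series by (intro sums_mult)
  have "summable (\<lambda>i. measure M (A i))"
    using s assms(2) by (intro summable_comparison_test'[OF sums_summable[OF s]]) auto
  then have "measure M (\<Union>i. A i) \<le> (\<Sum>i. measure M (A i))"
    using assms by (intro finite_measure_subadditive_countably)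
  also have "\<dots> \<le> (\<Sum>i. e * (1 / 2) ^ Suc i)"
    using \<open>summable _\<close> s assms(2) by (intro suminf_le sums_summable[OF s])
  also have "\<dots> = e" using s by (simp add: sums_iff)
  finally show ?thesis .
qed

text \<open>The induction runs over a class that is symmetric under complements: the inner approximants
  of the complements provide the case of countable intersections.\<close>

lemma compact_inner_approximation:
  fixes M :: "'a::metric_space measure"
  assumes lc: "locally_compact_space (euclidean :: 'a topology)"
    and sep: "separable_space (euclidean :: 'a topology)"
    and M: "sets M = sets borel" "finite_measure M"
    and A: "A \<in> sets borel"
    and e: "0 < e"
  obtains K where "compact K" "K \<subseteq> A" "measure M (A - K) < e"
proof -
  interpret finite_measure M by fact
  define P where "P A \<longleftrightarrow> (\<forall>e>0. \<exists>K. compact K \<and> K \<subseteq> A \<and> measure M (A - K) < e)" for A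
  have bor: "S \<in> sets M" if "compact S" for S :: "'a set"
    using borel_compact[OF that] M(1) by simp
  \<comment> \<open>Two errors of e/2 add up: one from replacing each \<open>A i\<close> by a
    compact \<open>K i\<close> with geometrically decreasing loss, one from truncating the union of
    the \<open>K i\<close> to finitely many terms.\<close>
  have P_Union: "P (\<Union>i. A i)" if A: "\<And>i. P (A i)" "\<And>i. A i \<in> sets borel" for A :: "nat \<Rightarrow> 'a set"
    unfolding P_def
  proof (intro allI impI)
    fix e :: real assume "0 < e"
    then have "\<exists>K. compact K \<and> K \<subseteq> A i \<and> measure M (A i - K) < (e / 2) * (1 / 2) ^ Suc i" for i
      using A(1)[of i, unfolded P_def, rule_format, of "(e / 2) * (1 / 2) ^ Suc i"] \<open>0 < e\<close> by simp
    then obtain K where K: "\<And>i. compact (K i)" "\<And>i. K i \<subseteq> A i"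
        "\<And>i. measure M (A i - K i) < (e / 2) * (1 / 2) ^ Suc i"
      by metis
    obtain n where n: "measure M ((\<Union>i. K i) - (\<Union>i<n. K i)) < e / 2"
      using measure_diff_finite_Union[of K "e / 2"] K(1) bor \<open>0 < e\<close> by auto
    have "measure M (\<Union>i. A i - K i) \<le> e / 2"
      using A(2) M(1) bor[OF K(1)] less_imp_le[OF K(3)] by (intro measure_Union_geometric) auto
    moreover have "measure M ((\<Union>i. A i) - (\<Union>i<n. K i)) \<le>
        measure M ((\<Union>i. A i - K i) \<union> ((\<Union>i. K i) - (\<Union>i<n. K i)))"
      using A(2) M(1) bor[OF K(1)] by (intro finite_measure_mono) auto
    moreover have "\<dots> \<le> measure M (\<Union>i. A i - K i) + measure M ((\<Union>i. K i) - (\<Union>i<n. K i))"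
      using A(2) M(1) bor[OF K(1)] by (intro measure_Un_le) auto
    ultimately have "measure M ((\<Union>i. A i) - (\<Union>i<n. K i)) < e"
      using n by linarith
    moreover have "compact (\<Union>i<n. K i)" using K by auto
    ultimately show "\<exists>K. compact K \<and> K \<subseteq> (\<Union>i. A i) \<and> measure M ((\<Union>i. A i) - K) < e"
      using K(2) by (intro exI[of _ "\<Union>i<n. K i"]) blast
  qed
  have P_Inter: "P (\<Inter>i. A i)" if A: "\<And>i. P (A i)" "\<And>i. A i \<in> sets borel" for A :: "nat \<Rightarrow> 'a set"
    unfolding P_def
  proof (intro allI impI)
    fix e :: real assume "0 < e"
    then have "\<exists>K. compact K \<and> K \<subseteq> A i \<and> measure M (A i - K) < (e / 2) * (1 / 2) ^ Suc i" for i
      using A(1)[of i, unfolded P_def, rule_format, of "(e / 2) * (1 / 2) ^ Suc i"] \<open>0 < e\<close> by simp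
    then obtain K where K: "\<And>i. compact (K i)" "\<And>i. K i \<subseteq> A i"
        "\<And>i. measure M (A i - K i) < (e / 2) * (1 / 2) ^ Suc i"
      by metis
    have "measure M (\<Union>i. A i - K i) \<le> e / 2"
      using A(2) M(1) bor[OF K(1)] less_imp_le[OF K(3)] by (intro measure_Union_geometric) auto
    moreover have "measure M ((\<Inter>i. A i) - (\<Inter>i. K i)) \<le> measure M (\<Union>i. A i - K i)"
      using A(2) M(1) bor[OF K(1)] by (intro finite_measure_mono) auto
    ultimately have "measure M ((\<Inter>i. A i) - (\<Inter>i. K i)) < e"
      using \<open>0 < e\<close> by linarith
    \<comment> \<open>The extra factor \<open>K 0\<close> exhibits the intersection as a closed
      subset of a compact set.\<close>
    moreover have "compact (K 0 \<inter> (\<Inter>i. K i))"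
      using K(1) by (intro compact_Int_closed closed_INT) (auto intro: compact_imp_closed)
    then have "compact (\<Inter>i. K i)"
      by (simp add: Int_absorb1 INF_lower)
    ultimately show "\<exists>K. compact K \<and> K \<subseteq> (\<Inter>i. A i) \<and> measure M ((\<Inter>i. A i) - K) < e"
      using K(2) by (intro exI[of _ "\<Inter>i. K i"]) blast
  qed
  have P_compact: "P K" if "compact K" for K
    unfolding P_def using that by (auto intro!: exI[of _ K])
  have "A \<in> sigma_sets UNIV {S. open S}"
    using A by (simp add: borel_def)
  then have "A \<in> sets borel \<and> P A \<and> P (- A)"
  proof induction
    case (Basic U)
    then have U: "open U" by simp
    obtain K :: "nat \<Rightarrow> 'a set" where K: "\<And>n. compact (K n)" "U = (\<Union>n. K n)"
      using open_eq_countable_Union_compact[OF lc sep U] by metis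
    \<comment> \<open>The complement of \<open>U\<close> is closed and the whole space is a
      countable union of compact sets \<open>L n\<close>, so the complement is the countable union
      of the compact sets \<open>L n \<inter> - U\<close>.\<close>
    obtain L :: "nat \<Rightarrow> 'a set" where L: "\<And>n. compact (L n)" "UNIV = (\<Union>n. L n)"
      using open_eq_countable_Union_compact[OF lc sep open_UNIV] by metis
    have c: "compact (L n \<inter> - U)" for n
      using L(1) U by (intro compact_Int_closed) auto
    have "- U = (\<Union>n. L n \<inter> - U)" using L(2) by blast
    moreover have "P (\<Union>n. L n \<inter> - U)"
      using c by (intro P_Union P_compact borel_compact) auto
    moreover have "P (\<Union>n. K n)"
      using K(1) by (intro P_Union P_compact borel_compact) auto
    ultimately show ?case using K(2)[symmetric] U by simp
  next
    case Empty
    obtain L :: "nat \<Rightarrow> 'a set" where L: "\<And>n. compact (L n)" "UNIV = (\<Union>n. L n)"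
      using open_eq_countable_Union_compact[OF lc sep open_UNIV] by metis
    have "P (\<Union>n. L n)"
      using L(1) by (intro P_Union P_compact borel_compact) auto
    then show ?case using P_compact[OF compact_empty] L(2)[symmetric] by simp
  next
    case (Compl A)
    then show ?case using borel_comp[of A] by (simp add: Compl_eq_Diff_UNIV[symmetric])
  next
    case (Union A)
    then have "A i \<in> sets borel" "- A i \<in> sets borel" "P (A i)" "P (- A i)" for i
      using borel_comp[of "A i"] by auto
    then have "(\<Union>i. A i) \<in> sets borel" "P (\<Union>i. A i)" "P (\<Inter>i. - A i)"
      using P_Union[of A] P_Inter[of "\<lambda>i. - A i"] by auto
    then show ?case by (simp add: Compl_UN)
  qed
  then show thesis using e that unfolding P_def by blast
qed

text \<open>Inner regularity is automatic on these spaces. This is what makes \<nu> and each of the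
  fibre measures constructed below Radon.\<close>

lemma finite_borel_measure_radon:
  fixes M :: "'a::metric_space measure"
  assumes lc: "locally_compact_space (euclidean :: 'a topology)"
    and sep: "separable_space (euclidean :: 'a topology)"
    and M: "sets M = sets borel" "finite_measure M"
  shows "M \<in> finite_radon_measures"
proof -
  interpret finite_measure M by fact
  have "emeasure M A = (SUP K\<in>{K. compact K \<and> K \<subseteq> A}. emeasure M K)" if A: "A \<in> sets borel" for A
  proof (rule antisym)
    show "emeasure M A \<le> (SUP K\<in>{K. compact K \<and> K \<subseteq> A}. emeasure M K)"
    proof (rule ennreal_le_epsilon)
      fix e :: real assume "0 < e"
      then obtain K where K: "compact K" "K \<subseteq> A" "measure M (A - K) < e"
        using compact_inner_approximation[OF lc sep M A] by blast
      have [measurable]: "K \<in> sets M" "A \<in> sets M" using borel_compact[OF K(1)] A M by auto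
      have "emeasure M A = emeasure M (K \<union> (A - K))"
        using K(2) by (intro arg_cong[of _ _ "emeasure M"]) auto
      also have "\<dots> = emeasure M K + emeasure M (A - K)"
        by (intro plus_emeasure[symmetric]) auto
      also have "\<dots> \<le> (SUP K\<in>{K. compact K \<and> K \<subseteq> A}. emeasure M K) + ennreal e"
        using K by (intro add_mono SUP_upper) (auto simp: emeasure_eq_measure intro!: ennreal_leI)
      finally show "emeasure M A \<le> (SUP K\<in>{K. compact K \<and> K \<subseteq> A}. emeasure M K) + ennreal e" .
    qed
    show "(SUP K\<in>{K. compact K \<and> K \<subseteq> A}. emeasure M K) \<le> emeasure M A"
      using A M by (intro SUP_least emeasure_mono) auto
  qed
  then show ?thesis using M by (auto simp: finite_radon_measures_def)
qed

text \<open>Inner approximants with error below 1/(n+1) are made increasing by taking finite unions;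
  what remains of \<open>A\<close> has measure below every 1/(n+1). A sequence, rather than one
  compact set per error, lets approximability of the densities be stated as an equation with a
  supremum.\<close>

lemma compact_exhaustion:
  fixes M :: "'a::metric_space measure"
  assumes lc: "locally_compact_space (euclidean :: 'a topology)"
    and sep: "separable_space (euclidean :: 'a topology)"
    and M: "sets M = sets borel" "finite_measure M"
    and A: "A \<in> sets borel"
  obtains K :: "nat \<Rightarrow> 'a set"
  where "\<And>n. compact (K n)" "incseq K" "(\<Union>n. K n) \<subseteq> A" "emeasure M (A - (\<Union>n. K n)) = 0"
proof -
  interpret finite_measure M by fact
  have "\<exists>K. compact K \<and> K \<subseteq> A \<and> measure M (A - K) < inverse (real (Suc n))" for n
    using compact_inner_approximation[OF lc sep M A, of "inverse (real (Suc n))"] by auto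
  then obtain k where k: "\<And>n. compact (k n)" "\<And>n. k n \<subseteq> A"
      "\<And>n. measure M (A - k n) < inverse (real (Suc n))"
    by metis
  define K where "K n = (\<Union>i\<le>n. k i)" for n
  have UK: "(\<Union>n. K n) = (\<Union>n. k n)" by (auto simp: K_def)
  have [measurable]: "k n \<in> sets M" "A \<in> sets M" for n
    using borel_compact[OF k(1)] A M by auto
  have "measure M (A - (\<Union>n. k n)) \<le> inverse (real (Suc n))" for n
  proof -
    have "measure M (A - (\<Union>n. k n)) \<le> measure M (A - k n)"
      by (intro finite_measure_mono) auto
    then show ?thesis using k(3)[of n] by linarith
  qed
  then have "measure M (A - (\<Union>n. k n)) \<le> 0"
    using LIMSEQ_inverse_real_of_nat by (intro LIMSEQ_le_const) auto
  then have "emeasure M (A - (\<Union>n. K n)) = 0"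
    unfolding UK by (simp add: emeasure_eq_measure measure_le_0_iff)
  moreover have "compact (K n)" for n using k(1) by (auto simp: K_def)
  moreover have "incseq K" unfolding K_def incseq_def by (meson UN_mono atMost_subset_iff order_refl)
  moreover have "(\<Union>n. K n) \<subseteq> A" using k(2) UK by auto
  ultimately show thesis using that by blast
qed

subsection \<open>Extension of compactly approximable contents\<close>

text \<open>If sets \<open>A i\<close> decrease to the empty set, so do compact approximants
  \<open>K i\<close> have empty intersection, and by compactness finitely many of them already do.
  Hence for large n the set \<open>A n\<close> is covered by finitely many differences
  \<open>A i - K i\<close> of small total content. Two algebras occur because additivity must cover
  these differences, while approximation is demanded, and the extension made, only on the smaller
  algebra \<open>\<A>\<close>.\<close>

lemma compact_approximable_content_extension:
  fixes f :: "'a::t2_space set \<Rightarrow> ennreal"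
  assumes \<B>: "algebra UNIV \<B>" and \<A>: "algebra UNIV \<A>" "\<A> \<subseteq> \<B>"
    and f: "positive \<B> f" "additive \<B> f" "f UNIV \<noteq> \<infinity>"
    and approx: "\<And>A e. A \<in> \<A> \<Longrightarrow> 0 < e \<Longrightarrow> \<exists>K\<in>\<B>. compact K \<and> K \<subseteq> A \<and> f A \<le> f K + ennreal e"
  obtains M where "sets M = sigma_sets UNIV \<A>" "\<And>A. A \<in> \<A> \<Longrightarrow> emeasure M A = f A"
proof -
  interpret \<B>: algebra UNIV \<B> by fact
  interpret \<A>: algebra UNIV \<A> by fact
  have mono: "f A \<le> f B" if "A \<in> \<B>" "B \<in> \<B>" "A \<subseteq> B" for A B
    using \<B>.additive_increasing[OF f(1,2)] that by (auto simp: increasing_def)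
  have fin: "f A \<noteq> \<infinity>" if "A \<in> \<B>" for A
    using mono[OF that \<B>.top] f(3) by (auto simp: top_unique)
  have "\<exists>\<mu>. (\<forall>s\<in>\<A>. \<mu> s = f s) \<and> measure_space UNIV (sigma_sets UNIV \<A>) \<mu>"
  \<comment> \<open>For a finite content, continuity at the empty set is enough for a countably
    additive extension.\<close>
  proof (rule \<A>.caratheodory_empty_continuous)
    show "positive \<A> f" "additive \<A> f"
      using f \<A>(2) by (auto simp: positive_def additive_def subset_iff)
    show "f A \<noteq> \<infinity>" if "A \<in> \<A>" for A using fin \<A>(2) that by auto
  next
    fix A :: "nat \<Rightarrow> 'a set"
    assume A: "range A \<subseteq> \<A>" "decseq A" "(\<Inter>i. A i) = {}"
    have A_in: "A i \<in> \<A>" "A i \<in> \<B>" for i using A(1) \<A>(2) by auto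
    show "(\<lambda>i. f (A i)) \<longlonglongrightarrow> 0"
    proof (rule order_tendstoI)
      fix a :: ennreal assume "0 < a"
      then obtain b where b: "0 < b" "b < a" using dense by blast
      then obtain e where e: "b = ennreal e" "0 < e"
        by (cases b) (auto simp: ennreal_less_zero_iff)
      have "\<exists>K\<in>\<B>. compact K \<and> K \<subseteq> A i \<and> f (A i) \<le> f K + ennreal (e * (1 / 2) ^ Suc i)" for i
        using A_in e by (intro approx) auto
      then obtain K where K: "\<And>i. K i \<in> \<B>" "\<And>i. compact (K i)" "\<And>i. K i \<subseteq> A i"
          "\<And>i. f (A i) \<le> f (K i) + ennreal (e * (1 / 2) ^ Suc i)"
        by metis
      have D: "A i - K i \<in> \<B>" for i using A_in K by auto
      have fD: "f (A i - K i) \<le> ennreal (e * (1 / 2) ^ Suc i)" for i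
      proof -
        have "f (K i \<union> (A i - K i)) = f (K i) + f (A i - K i)"
          using f(2) K(1) D unfolding additive_def by blast
        also have "K i \<union> (A i - K i) = A i" using K(3) by auto
        finally have "f (K i) + f (A i - K i) \<le> f (K i) + ennreal (e * (1 / 2) ^ Suc i)"
          using K(4)[of i] by simp
        then show ?thesis using fin[OF K(1)[of i]] by (simp add: ennreal_add_left_cancel_le)
      qed
      have "K 0 \<inter> (\<Inter>i. K i) = {}" using A(3) K(3) by blast
      then obtain J where J: "finite J" "K 0 \<inter> (\<Inter>i\<in>J. K i) = {}"
        using compact_imp_fip_image[of "K 0" UNIV K] K(2) compact_imp_closed by blast
      \<comment> \<open>Inserting 0 keeps \<open>Max\<close> meaningful for empty \<open>J\<close>
        and puts the index of \<open>K 0\<close> below \<open>N\<close>.\<close>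
      define N where "N = Suc (Max (insert 0 J))"
      have N: "J \<subseteq> {..<N}" "0 < N" using J(1) by (auto simp: N_def less_Suc_eq_le)
      have "f (A n) < a" if n: "N \<le> n" for n
      proof -
        have "A n \<subseteq> (\<Union>i<N. A i - K i)"
        proof
          fix x assume x: "x \<in> A n"
          have "x \<in> A i" if "i < N" for i
            using A(2) x that decseqD[of A i n] n by auto
          moreover have "\<exists>i<N. x \<notin> K i" using J(2) N by blast
          ultimately show "x \<in> (\<Union>i<N. A i - K i)" by blast
        qed
        then have "f (A n) \<le> f (\<Union>i<N. A i - K i)"
          using A_in D by (intro mono) auto
        also have "\<dots> \<le> (\<Sum>i<N. f (A i - K i))"
          using D by (intro \<B>.subadditive f) auto
        also have "\<dots> \<le> (\<Sum>i<N. ennreal (e * (1 / 2) ^ Suc i))"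
          using fD by (rule sum_mono)
        also have "\<dots> = ennreal (\<Sum>i<N. e * (1 / 2) ^ Suc i)"
          using e by (intro sum_ennreal) auto
        also have "(\<Sum>i<N. e * (1 / 2) ^ Suc i) = e * (1 - (1 / 2) ^ N)"
          by (induction N) (auto simp: field_simps)
        also have "ennreal \<dots> \<le> ennreal e"
          using e by (intro ennreal_leI) (auto simp: field_simps)
        finally show ?thesis using b e by auto
      qed
      then show "eventually (\<lambda>i. f (A i) < a) sequentially"
        by (auto simp: eventually_sequentially)
    qed auto
  qed
  then obtain \<mu> where \<mu>: "\<And>s. s \<in> \<A> \<Longrightarrow> \<mu> s = f s" "measure_space UNIV (sigma_sets UNIV \<A>) \<mu>"
    by blast
  define M where "M = measure_of UNIV (sigma_sets UNIV \<A>) \<mu>"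
  show thesis
  proof
    show "sets M = sigma_sets UNIV \<A>"
      by (simp add: M_def sigma_sets_sigma_sets_eq)
    show "emeasure M A = f A" if "A \<in> \<A>" for A
      using that \<mu> unfolding M_def
      by (subst emeasure_measure_of_sigma) (auto simp: measure_space_def)
  qed
qed

text \<open>A finite subfamily \<open>F\<close> cuts the space into finitely many atoms, hence
  contributes only finitely many sets, and a countable family has countably many finite subfamilies.
  Sets coming from \<open>F\<close> and \<open>G\<close> are combined over
  \<open>F \<union> G\<close>.\<close>

lemma countable_algebra_generated:
  fixes \<E> :: "'a set set"
  assumes "countable \<E>"
  obtains \<A> where "algebra UNIV \<A>" "countable \<A>" "\<E> \<subseteq> \<A>" "\<A> \<subseteq> sigma_sets UNIV \<E>"
proof -
  \<comment> \<open>Sets in \<open>\<A>\<close> are those for which membership of \<open>x\<close> depends only on \<open>a F x\<close> for some finite \<open>F\<close>.\<close>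
  define a where "a F x = {E \<in> F. x \<in> E}" for F and x :: 'a
  define \<A> where "\<A> = (\<Union>F\<in>{F. finite F \<and> F \<subseteq> \<E>}. (\<lambda>S. a F -` S) ` Pow (Pow F))"
  have \<A>I: "a F -` S \<in> \<A>" if "finite F" "F \<subseteq> \<E>" for F S
  proof -
    \<comment> \<open>The definition admits only \<open>S \<subseteq> Pow F\<close>, which keeps the
      family countable; since \<open>a F x\<close> is always a subset of \<open>F\<close>, an
      arbitrary \<open>S\<close> may be cut down to this form.\<close>
    have "a F -` S = a F -` (S \<inter> Pow F)" by (auto simp: a_def)
    moreover have "a F -` (S \<inter> Pow F) \<in> \<A>"
      unfolding \<A>_def using that by blast
    ultimately show ?thesis by simp
  qed
  have \<A>E: "\<exists>F S. finite F \<and> F \<subseteq> \<E> \<and> A = a F -` S" if "A \<in> \<A>" for A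
    using that by (auto simp: \<A>_def)
  have "algebra UNIV \<A>"
    unfolding algebra_iff_Un
  proof (intro conjI ballI)
    show "{} \<in> \<A>" using \<A>I[of "{}" "{}"] by simp
    show "UNIV - A \<in> \<A>" if A: "A \<in> \<A>" for A
    proof -
      obtain F S where F: "finite F" "F \<subseteq> \<E>" "A = a F -` S"
        using \<A>E[OF A] by blast
      have "UNIV - A = a F -` (- S)" using F by auto
      then show ?thesis using \<A>I F by metis
    qed
    show "A \<union> B \<in> \<A>" if A: "A \<in> \<A>" and B: "B \<in> \<A>" for A B
    proof -
      obtain F S where F: "finite F" "F \<subseteq> \<E>" "A = a F -` S"
        using \<A>E[OF A] by blast
      obtain G T where G: "finite G" "G \<subseteq> \<E>" "B = a G -` T"
        using \<A>E[OF B] by blast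
      have "a (F \<union> G) x \<inter> F = a F x" "a (F \<union> G) x \<inter> G = a G x" for x
        by (auto simp: a_def)
      then have "A \<union> B = a (F \<union> G) -` {R. R \<inter> F \<in> S \<or> R \<inter> G \<in> T}"
        using F G by auto
      moreover have "\<dots> \<in> \<A>" using F G by (intro \<A>I) auto
      ultimately show ?thesis by simp
    qed
  qed simp
  moreover have "countable \<A>"
    unfolding \<A>_def
    by (intro countable_UN countable_Collect_finite_subset assms countable_image countable_finite) auto
  moreover have "E \<in> \<A>" if "E \<in> \<E>" for E
  proof -
    have "E = a {E} -` {{E}}" by (auto simp: a_def)
    moreover have "\<dots> \<in> \<A>" using that by (intro \<A>I) auto
    ultimately show ?thesis by simp
  qed
  moreover have "A \<in> sigma_sets UNIV \<E>" if A: "A \<in> \<A>" for A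
  proof -
    obtain F S where F: "finite F" "F \<subseteq> \<E>" "S \<subseteq> Pow F" "A = a F -` S"
      using A unfolding \<A>_def by blast
    let ?M = "sigma UNIV \<E>"
    \<comment> \<open>Membership in \<open>A\<close> is rewritten as a finite Boolean combination of
      memberships in the generators.\<close>
    have "{x \<in> space ?M. \<exists>T\<in>S. \<forall>E\<in>F. (x \<in> E) = (E \<in> T)} \<in> sets ?M"
    proof (intro sets.sets_Collect_finite_Ex sets.sets_Collect_finite_All)
      show "finite S" using F(1) by (intro finite_subset[OF F(3)]) simp
      show "{x \<in> space ?M. (x \<in> E) = (E \<in> T)} \<in> sets ?M" if "E \<in> F" for E T
      proof -
        have E: "E \<in> sets ?M" using that F by auto
        have "{x \<in> space ?M. (x \<in> E) = (E \<in> T)} = (if E \<in> T then E else UNIV - E)"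
          by (auto simp: space_measure_of_conv)
        then show ?thesis using E sets.compl_sets[OF E] by (auto simp: space_measure_of_conv)
      qed
    qed (use F in auto)
    moreover have "A = {x \<in> space ?M. \<exists>T\<in>S. \<forall>E\<in>F. (x \<in> E) = (E \<in> T)}"
    proof -
      have "a F x \<in> S \<longleftrightarrow> (\<exists>T\<in>S. \<forall>E\<in>F. (x \<in> E) = (E \<in> T))" for x
      proof
        assume "a F x \<in> S"
        then show "\<exists>T\<in>S. \<forall>E\<in>F. (x \<in> E) = (E \<in> T)"
          by (intro bexI[of _ "a F x"]) (auto simp: a_def)
      next
        assume "\<exists>T\<in>S. \<forall>E\<in>F. (x \<in> E) = (E \<in> T)"
        then obtain T where T: "T \<in> S" "\<forall>E\<in>F. (x \<in> E) = (E \<in> T)" by blast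
        then have "a F x = T" using F(3) by (auto simp: a_def)
        then show "a F x \<in> S" using T by simp
      qed
      then show ?thesis using F by (auto simp: space_measure_of_conv)
    qed
    ultimately show ?thesis by simp
  qed
  ultimately show thesis using that by blast
qed

subsection \<open>Conditional densities\<close>

locale finite_measure_map = finite_measure M for M :: "'a measure" +
  fixes N :: "'b measure" and \<pi> :: "'a \<Rightarrow> 'b"
  assumes measurable_map[measurable]: "\<pi> \<in> M \<rightarrow>\<^sub>M N"
begin

text \<open>A version of the conditional probability of \<open>A\<close> given that \<pi> takes the
  value y, determined only up to null sets of the image measure.\<close>

definition cond_density :: "'a set \<Rightarrow> 'b \<Rightarrow> ennreal" where
  "cond_density A = RN_deriv (distr M N \<pi>) (distr (density M (indicator A)) N \<pi>)"

lemma borel_measurable_cond_density[measurable]: "cond_density A \<in> borel_measurable N"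
  using borel_measurable_RN_deriv[of "distr M N \<pi>"] by (simp add: cond_density_def)

sublocale distr: finite_measure "distr M N \<pi>"
  by (rule finite_measure_distr) measurable

text \<open>The image of \<open>M\<close> restricted to \<open>A\<close> is dominated by the image
  of \<open>M\<close>, hence absolutely continuous with respect to it, and the Radon-Nikodym theorem
  applies.\<close>

lemma nn_integral_cond_density:
  assumes [measurable]: "A \<in> sets M" "B \<in> sets N"
  shows "(\<integral>\<^sup>+y. cond_density A y * indicator B y \<partial>distr M N \<pi>) = emeasure M (A \<inter> \<pi> -` B)"
proof -
  let ?D = "distr (density M (indicator A)) N \<pi>"
  have D: "emeasure ?D C = emeasure M (A \<inter> \<pi> -` C)" if [measurable]: "C \<in> sets N" for C
  proof -
    have "emeasure ?D C = (\<integral>\<^sup>+x. indicator A x * indicator (\<pi> -` C \<inter> space M) x \<partial>M)"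
      by (simp add: emeasure_distr emeasure_density)
    also have "\<dots> = (\<integral>\<^sup>+x. indicator (A \<inter> (\<pi> -` C \<inter> space M)) x \<partial>M)"
      by (simp add: indicator_inter_arith)
    also have "\<dots> = emeasure M (A \<inter> (\<pi> -` C \<inter> space M))"
      by (intro nn_integral_indicator) measurable
    also have "A \<inter> (\<pi> -` C \<inter> space M) = A \<inter> \<pi> -` C"
      using sets.sets_into_space[OF \<open>A \<in> sets M\<close>] by auto
    finally show ?thesis .
  qed
  have "absolutely_continuous (distr M N \<pi>) ?D"
    unfolding absolutely_continuous_def
  proof
    fix C assume "C \<in> null_sets (distr M N \<pi>)"
    then have C: "C \<in> sets N" "emeasure M (\<pi> -` C \<inter> space M) = 0"
      by (auto simp: null_sets_def emeasure_distr)
    have "emeasure M (A \<inter> \<pi> -` C) \<le> emeasure M (\<pi> -` C \<inter> space M)"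
      using C sets.sets_into_space[OF \<open>A \<in> sets M\<close>] by (intro emeasure_mono) auto
    then show "C \<in> null_sets ?D" using C by (auto simp: null_sets_def D)
  qed
  then have "density (distr M N \<pi>) (cond_density A) = ?D"
    unfolding cond_density_def by (intro distr.density_RN_deriv) auto
  then have "emeasure ?D B = (\<integral>\<^sup>+y. cond_density A y * indicator B y \<partial>distr M N \<pi>)"
    using emeasure_density[of "cond_density A" "distr M N \<pi>" B] by simp
  then show ?thesis by (simp add: D)
qed

text \<open>The source of all almost-everywhere identities below: a candidate is compared with the
  density by integrating over every measurable \<open>B\<close>.\<close>

lemma cond_density_unique:
  assumes [measurable]: "A \<in> sets M" "f \<in> borel_measurable N"
    and f: "\<And>B. B \<in> sets N \<Longrightarrow>
      (\<integral>\<^sup>+y. f y * indicator B y \<partial>distr M N \<pi>) = emeasure M (A \<inter> \<pi> -` B)"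
  shows "AE y in distr M N \<pi>. f y = cond_density A y"
proof (rule distr.density_unique)
  show "density (distr M N \<pi>) f = density (distr M N \<pi>) (cond_density A)"
    by (rule measure_eqI) (auto simp: emeasure_density f nn_integral_cond_density)
qed auto

lemma cond_density_Un:
  assumes [measurable]: "A \<in> sets M" "A' \<in> sets M" and "A \<inter> A' = {}"
  shows "AE y in distr M N \<pi>. cond_density A y + cond_density A' y = cond_density (A \<union> A') y"
proof (rule cond_density_unique)
  fix B assume B[measurable]: "B \<in> sets N"
  have "A \<inter> \<pi> -` B = A \<inter> (\<pi> -` B \<inter> space M)" "A' \<inter> \<pi> -` B = A' \<inter> (\<pi> -` B \<inter> space M)"
    using assms(1,2)[THEN sets.sets_into_space] by auto
  then have [measurable]: "A \<inter> \<pi> -` B \<in> sets M" "A' \<inter> \<pi> -` B \<in> sets M" by auto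
  have "(\<integral>\<^sup>+y. (cond_density A y + cond_density A' y) * indicator B y \<partial>distr M N \<pi>) =
      emeasure M (A \<inter> \<pi> -` B) + emeasure M (A' \<inter> \<pi> -` B)"
    by (simp add: distrib_right nn_integral_add nn_integral_cond_density)
  also have "\<dots> = emeasure M ((A \<inter> \<pi> -` B) \<union> (A' \<inter> \<pi> -` B))"
    using assms(3) by (intro plus_emeasure) auto
  finally show "(\<integral>\<^sup>+y. (cond_density A y + cond_density A' y) * indicator B y \<partial>distr M N \<pi>) =
      emeasure M ((A \<union> A') \<inter> \<pi> -` B)"
    by (simp add: Int_Un_distrib2)
qed auto

lemma cond_density_space: "AE y in distr M N \<pi>. 1 = cond_density (space M) y"
proof (rule cond_density_unique)
  fix B assume [measurable]: "B \<in> sets N"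
  then show "(\<integral>\<^sup>+y. 1 * indicator B y \<partial>distr M N \<pi>) = emeasure M (space M \<inter> \<pi> -` B)"
    by (simp add: emeasure_distr Int_commute)
qed auto

text \<open>Monotone convergence carries the exhaustion of \<open>A\<close> over to the densities.
  It is needed in its almost-everywhere form, as each density is only a version.\<close>

lemma cond_density_SUP:
  assumes [measurable]: "A \<in> sets M" and K[measurable]: "\<And>n :: nat. K n \<in> sets M"
    and "incseq K" "(\<Union>n. K n) \<subseteq> A" "emeasure M (A - (\<Union>n. K n)) = 0"
  shows "AE y in distr M N \<pi>. (SUP n. cond_density (K n) y) = cond_density A y"
proof (rule cond_density_unique)
  \<comment> \<open>Monotonicity comes from additivity: the increment is the density of
    \<open>K (Suc n) - K n\<close>, which is nonnegative.\<close>
  have incr: "AE y in distr M N \<pi>. cond_density (K n) y \<le> cond_density (K (Suc n)) y" for n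
  proof -
    have "K n \<union> (K (Suc n) - K n) = K (Suc n)"
      using incseq_SucD[OF assms(3)] by auto
    then have "AE y in distr M N \<pi>. cond_density (K n) y + cond_density (K (Suc n) - K n) y =
        cond_density (K (Suc n)) y"
      using cond_density_Un[of "K n" "K (Suc n) - K n"] by simp
    then show ?thesis by eventually_elim (metis le_iff_add)
  qed
  fix B assume B[measurable]: "B \<in> sets N"
  have e: "S \<inter> \<pi> -` B = S \<inter> (\<pi> -` B \<inter> space M)" if "S \<in> sets M" for S
    using sets.sets_into_space[OF that] by auto
  have m: "S \<inter> \<pi> -` B \<in> sets M" if [measurable]: "S \<in> sets M" for S
    unfolding e[OF that] by measurable
  have "(\<integral>\<^sup>+y. (SUP n. cond_density (K n) y) * indicator B y \<partial>distr M N \<pi>) =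
      (\<integral>\<^sup>+y. (SUP n. cond_density (K n) y * indicator B y) \<partial>distr M N \<pi>)"
    by (simp add: SUP_mult_right_ennreal)
  also have "\<dots> = (SUP n. \<integral>\<^sup>+y. cond_density (K n) y * indicator B y \<partial>distr M N \<pi>)"
  proof (rule nn_integral_monotone_convergence_SUP_AE)
    show "AE y in distr M N \<pi>. cond_density (K n) y * indicator B y
        \<le> cond_density (K (Suc n)) y * indicator B y" for n
      using incr[of n] by eventually_elim (auto intro: mult_right_mono)
  qed auto
  also have "\<dots> = (SUP n. emeasure M (K n \<inter> \<pi> -` B))"
    by (simp add: nn_integral_cond_density)
  also have "\<dots> = emeasure M (\<Union>n. K n \<inter> \<pi> -` B)"
    using assms(3) m[OF K] by (intro SUP_emeasure_incseq) (auto simp: incseq_def)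
  also have "(\<Union>n. K n \<inter> \<pi> -` B) = (\<Union>n. K n) \<inter> \<pi> -` B"
    by auto
  also have "emeasure M \<dots> = emeasure M (A \<inter> \<pi> -` B)"
  proof (rule emeasure_eq_AE)
    have "A - (\<Union>n. K n) \<in> null_sets M" using assms(5) by (auto simp: null_sets_def)
    then show "AE x in M. x \<in> (\<Union>n. K n) \<inter> \<pi> -` B \<longleftrightarrow> x \<in> A \<inter> \<pi> -` B"
      by (rule AE_I') (use assms(4) in blast)
  qed (auto intro!: m)
  finally show "(\<integral>\<^sup>+y. (SUP n. cond_density (K n) y) * indicator B y \<partial>distr M N \<pi>) =
      emeasure M (A \<inter> \<pi> -` B)" .
qed auto

end

subsection \<open>Disintegration\<close>

text \<open>The integral identity is localised to sets \<open>B\<close> of the target: the whole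
  space gives the disintegration formula, and complements of basic open sets give concentration on
  fibres. The bound by 1 at every y makes even the exceptional measures finite.\<close>

lemma disintegration_kernel:
  fixes M :: "'a::metric_space measure" and N :: "'b measure"
  assumes lc: "locally_compact_space (euclidean :: 'a topology)"
    and sep: "separable_space (euclidean :: 'a topology)"
    and M: "sets M = sets borel" "finite_measure M"
    and \<pi>: "\<pi> \<in> M \<rightarrow>\<^sub>M N"
  obtains \<kappa> :: "'b \<Rightarrow> 'a measure"
  where "\<And>y. sets (\<kappa> y) = sets borel" "\<And>y. emeasure (\<kappa> y) UNIV \<le> 1"
    "AE y in distr M N \<pi>. emeasure (\<kappa> y) UNIV = 1"
    "\<And>A. A \<in> sets borel \<Longrightarrow> (\<lambda>y. emeasure (\<kappa> y) A) \<in> borel_measurable N"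
    "\<And>A B. A \<in> sets borel \<Longrightarrow> B \<in> sets N \<Longrightarrow>
      (\<integral>\<^sup>+y. emeasure (\<kappa> y) A * indicator B y \<partial>distr M N \<pi>) = emeasure M (A \<inter> \<pi> -` B)"
proof -
  interpret finite_measure_map M N \<pi>
    using M \<pi> by (simp add: finite_measure_map_def finite_measure_map_axioms_def)
  have spM: "space M = UNIV" using sets_eq_imp_space_eq[OF M(1)] by simp
  obtain \<E> :: "'a set set" where \<E>: "countable \<E>" "topological_basis \<E>"
    using separable_metric_countable_basis[OF sep] by metis
  have bor: "sets borel = sigma_sets UNIV \<E>"
    unfolding borel_eq_countable_basis[OF \<E>] by simp
  obtain \<A> where \<A>: "algebra UNIV \<A>" "countable \<A>" "\<E> \<subseteq> \<A>" "\<A> \<subseteq> sigma_sets UNIV \<E>"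
    using countable_algebra_generated[OF \<E>(1)] by metis
  have \<A>_borel: "A \<in> sets borel" if "A \<in> \<A>" for A using \<A> bor that by auto
  have sig: "sigma_sets UNIV \<A> = sets borel"
    unfolding bor using \<A> by (intro sigma_sets_eqI) auto
  have "\<forall>A\<in>\<A>. \<exists>K :: nat \<Rightarrow> 'a set. (\<forall>n. compact (K n)) \<and> incseq K \<and> (\<Union>n. K n) \<subseteq> A \<and>
      emeasure M (A - (\<Union>n. K n)) = 0"
    using compact_exhaustion[OF lc sep M \<A>_borel] by metis
  then obtain K :: "'a set \<Rightarrow> nat \<Rightarrow> 'a set" where K: "\<And>A n. A \<in> \<A> \<Longrightarrow> compact (K A n)"
      "\<And>A. A \<in> \<A> \<Longrightarrow> incseq (K A)" "\<And>A. A \<in> \<A> \<Longrightarrow> (\<Union>n. K A n) \<subseteq> A"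
      "\<And>A. A \<in> \<A> \<Longrightarrow> emeasure M (A - (\<Union>n. K A n)) = 0"
    by metis
  have K_borel: "K A n \<in> sets borel" if "A \<in> \<A>" for A n
    using K(1)[OF that] by (rule borel_compact)
  \<comment> \<open>The algebra generated by \<open>\<K>\<close> contains the approximating compact
    sets and their differences from members of \<open>\<A>\<close>. Only members of
    \<open>\<A>\<close> need approximation, so no further enlargement follows.\<close>
  define \<K> where "\<K> = \<A> \<union> (\<Union>A\<in>\<A>. range (K A))"
  have "countable \<K>" using \<A>(2) by (auto simp: \<K>_def)
  then obtain \<B> where \<B>: "algebra UNIV \<B>" "countable \<B>" "\<K> \<subseteq> \<B>" "\<B> \<subseteq> sigma_sets UNIV \<K>"
    using countable_algebra_generated by metis
  have "\<K> \<subseteq> sets borel" using \<A>_borel K_borel by (auto simp: \<K>_def)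
  then have \<B>_borel: "B \<in> sets borel" if "B \<in> \<B>" for B
    using \<B>(4) that sets.sigma_sets_subset[of \<K> "borel :: 'a measure"] by auto
  interpret \<A>: algebra UNIV \<A> by fact
  interpret \<B>: algebra UNIV \<B> by fact

  \<comment> \<open>Only countably many conditions are imposed, so their exceptional null sets can
    be united.\<close>
  define good where "good y \<longleftrightarrow> 1 = cond_density UNIV y \<and>
    (\<forall>A\<in>\<B>. \<forall>B\<in>\<B>. A \<inter> B = {} \<longrightarrow> cond_density A y + cond_density B y = cond_density (A \<union> B) y) \<and>
    (\<forall>A\<in>\<A>. (SUP n. cond_density (K A n) y) = cond_density A y)" for y
  have AE_good: "AE y in distr M N \<pi>. good y"
    unfolding good_def
  proof (intro AE_conjI AE_ball_countable[THEN iffD2] ballI \<A>(2) \<B>(2))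
    show "AE y in distr M N \<pi>. 1 = cond_density UNIV y"
      using cond_density_space spM by simp
    show "AE y in distr M N \<pi>. A \<inter> B = {} \<longrightarrow>
        cond_density A y + cond_density B y = cond_density (A \<union> B) y" if "A \<in> \<B>" "B \<in> \<B>" for A B
      using cond_density_Un[of A B] that \<B>_borel M by (cases "A \<inter> B = {}") auto
    show "AE y in distr M N \<pi>. (SUP n. cond_density (K A n) y) = cond_density A y" if "A \<in> \<A>" for A
      using that \<A>_borel K_borel M K by (intro cond_density_SUP) auto
  qed
  have ex: "\<exists>\<kappa>. sets \<kappa> = sets borel \<and> (\<forall>A\<in>\<A>. emeasure \<kappa> A = cond_density A y)" if "good y" for y
  proof -
    let ?f = "\<lambda>A. cond_density A y"
    have add: "additive \<B> ?f" and one: "?f UNIV = 1"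
      and SUP: "\<And>A. A \<in> \<A> \<Longrightarrow> (SUP n. ?f (K A n)) = ?f A"
      using that by (auto simp: good_def additive_def)
    \<comment> \<open>Additivity on the disjoint pair of \<open>{}\<close> and \<open>UNIV\<close>
      forces the value 0 at \<open>{}\<close>, because the total mass 1 can be cancelled.\<close>
    have "?f {} + ?f UNIV = ?f UNIV"
      using add[unfolded additive_def, rule_format, of "{}" UNIV] by simp
    then have pos: "positive \<B> ?f"
      using one by (simp add: positive_def)
    have le: "?f A \<le> 1" if "A \<in> \<B>" for A
      using \<B>.additive_increasing[OF pos add] that one
      unfolding increasing_def by (metis \<B>.top subset_UNIV)
    have \<A>\<B>: "\<A> \<subseteq> \<B>" using \<B> by (auto simp: \<K>_def)
    have "\<exists>L\<in>\<B>. compact L \<and> L \<subseteq> A \<and> ?f A \<le> ?f L + ennreal e" if A: "A \<in> \<A>" "0 < e" for A e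
    proof -
      have "?f A \<noteq> \<infinity>" using le[of A] that \<A>\<B> by (auto simp: top_unique)
      then obtain n where "?f A < ?f (K A n) + ennreal e"
        using SUP_approx_ennreal[of e UNIV "?f A" "\<lambda>n. ?f (K A n)"] SUP[OF A(1)] A(2) by auto
      moreover have "K A n \<in> \<B>" using \<B>(3) A(1) unfolding \<K>_def by blast
      moreover have "K A n \<subseteq> A" using K(3)[OF A(1)] by blast
      ultimately show ?thesis using K(1)[OF A(1)] by (intro bexI[of _ "K A n"]) auto
    qed
    then obtain \<kappa> where "sets \<kappa> = sigma_sets UNIV \<A>" "\<And>A. A \<in> \<A> \<Longrightarrow> emeasure \<kappa> A = ?f A"
      using compact_approximable_content_extension[OF \<B>(1) \<A>(1) \<A>\<B> pos add] one by (metis ennreal_one_neq_top infinity_ennreal_def)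
    then show ?thesis using sig by metis
  qed
  \<comment> \<open>The good points are replaced by a measurable subset \<open>G\<close> of full
    measure, so that \<open>indicator G\<close> is measurable.\<close>
  obtain Z where Z: "{y \<in> space N. \<not> good y} \<subseteq> Z" "emeasure (distr M N \<pi>) Z = 0" "Z \<in> sets N"
    using AE_E[OF AE_good] by auto
  define G where "G = space N - Z"
  have [measurable]: "G \<in> sets N" using Z by (auto simp: G_def)
  have AE_G: "AE y in distr M N \<pi>. y \<in> G"
    using Z by (intro AE_I'[of Z]) (auto simp: G_def null_sets_def)
  \<comment> \<open>The choice does not endanger measurability in y: on \<open>\<A>\<close> the
    values are prescribed by the densities on \<open>G\<close>, and by 0 elsewhere.\<close>
  define \<kappa> where "\<kappa> y = (if y \<in> G
    then SOME \<kappa>. sets \<kappa> = sets borel \<and> (\<forall>A\<in>\<A>. emeasure \<kappa> A = cond_density A y)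
    else null_measure borel)" for y
  have \<kappa>: "sets (\<kappa> y) = sets borel \<and> (\<forall>A\<in>\<A>. emeasure (\<kappa> y) A = cond_density A y)" if "y \<in> G" for y
  proof -
    have "good y" using that Z by (auto simp: G_def)
    then show ?thesis
      using someI_ex[OF ex] that by (simp add: \<kappa>_def)
  qed
  have sets_\<kappa>: "sets (\<kappa> y) = sets borel" for y
    using \<kappa>[of y] by (cases "y \<in> G") (auto simp: \<kappa>_def)
  have \<kappa>_\<A>: "emeasure (\<kappa> y) A = cond_density A y * indicator G y" if "A \<in> \<A>" for A y
    using \<kappa>[of y] that by (cases "y \<in> G") (auto simp: \<kappa>_def)
  have one: "emeasure (\<kappa> y) UNIV = indicator G y" for y
  proof (cases "y \<in> G")
    case True
    then have "good y" using Z by (auto simp: G_def)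
    then show ?thesis using \<kappa>_\<A>[OF \<A>.top, of y] True by (simp add: good_def)
  next
    case False
    then show ?thesis using \<kappa>_\<A>[OF \<A>.top, of y] by simp
  qed
  \<comment> \<open>Measurability and the integral identity are carried together through the
    induction over the Dynkin system generated by \<open>\<A>\<close>, because the integral steps
    need measurability.\<close>
  define Q where "Q A \<longleftrightarrow> (\<lambda>y. emeasure (\<kappa> y) A) \<in> borel_measurable N \<and>
    (\<forall>B\<in>sets N. (\<integral>\<^sup>+y. emeasure (\<kappa> y) A * indicator B y \<partial>distr M N \<pi>) = emeasure M (A \<inter> \<pi> -` B))" for A
  have Q_\<A>: "Q A" if "A \<in> \<A>" for A
    unfolding Q_def
  proof (intro conjI ballI)
    show "(\<lambda>y. emeasure (\<kappa> y) A) \<in> borel_measurable N"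
      unfolding \<kappa>_\<A>[OF that] by measurable
    fix B assume "B \<in> sets N"
    then have "(\<integral>\<^sup>+y. cond_density A y * indicator B y \<partial>distr M N \<pi>) = emeasure M (A \<inter> \<pi> -` B)"
      using that \<A>_borel M by (intro nn_integral_cond_density) auto
    moreover have "(\<integral>\<^sup>+y. emeasure (\<kappa> y) A * indicator B y \<partial>distr M N \<pi>) =
        (\<integral>\<^sup>+y. cond_density A y * indicator B y \<partial>distr M N \<pi>)"
      using AE_G by (intro nn_integral_cong_AE) (auto simp: \<kappa>_\<A>[OF that] elim!: eventually_mono)
    ultimately show "(\<integral>\<^sup>+y. emeasure (\<kappa> y) A * indicator B y \<partial>distr M N \<pi>) = emeasure M (A \<inter> \<pi> -` B)"
      by simp
  qed
  have pre: "A \<inter> \<pi> -` B \<in> sets M" if "A \<in> sets borel" "B \<in> sets N" for A B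
    using that measurable_sets[OF \<pi> that(2)] M spM by auto
  have Q: "Q A" if "A \<in> sets borel" for A
  proof -
    have "Int_stable \<A>" by (auto simp: Int_stable_def)
    moreover have "\<A> \<subseteq> Pow UNIV" by simp
    moreover have "A \<in> sigma_sets UNIV \<A>" using that sig by simp
    ultimately show ?thesis
    proof (induction rule: sigma_sets_induct_disjoint)
      case (basic A)
      then show ?case by (rule Q_\<A>)
    next
      case empty
      then show ?case by (simp add: Q_def)
    next
      case (compl A)
      then have A: "A \<in> sets borel" and [measurable]: "(\<lambda>y. emeasure (\<kappa> y) A) \<in> borel_measurable N"
        using sig by (auto simp: Q_def)
      have le: "emeasure (\<kappa> y) A \<le> emeasure (\<kappa> y) UNIV" for y
        using sets_\<kappa> by (intro emeasure_mono) auto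
      have eq: "emeasure (\<kappa> y) (UNIV - A) = indicator G y - emeasure (\<kappa> y) A" for y
      proof -
        have "emeasure (\<kappa> y) A \<noteq> \<infinity>"
          using le[of y] one[of y] by (cases "y \<in> G") (auto simp: top_unique)
        then show ?thesis
          using emeasure_Diff[of "\<kappa> y" A UNIV] A sets_\<kappa> one by auto
      qed
      have [measurable]: "(\<lambda>y. emeasure (\<kappa> y) (UNIV - A)) \<in> borel_measurable N"
        unfolding eq by measurable
      have "(\<integral>\<^sup>+y. emeasure (\<kappa> y) (UNIV - A) * indicator B y \<partial>distr M N \<pi>) = emeasure M ((UNIV - A) \<inter> \<pi> -` B)"
        if B[measurable]: "B \<in> sets N" for B
      proof -
        \<comment> \<open>Adding the identity for \<open>A\<close> avoids subtracting integrals; the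
          common term is finite and is cancelled at the end.\<close>
        have "emeasure M (A \<inter> \<pi> -` B) + (\<integral>\<^sup>+y. emeasure (\<kappa> y) (UNIV - A) * indicator B y \<partial>distr M N \<pi>) =
            (\<integral>\<^sup>+y. emeasure (\<kappa> y) A * indicator B y + emeasure (\<kappa> y) (UNIV - A) * indicator B y \<partial>distr M N \<pi>)"
          using compl B by (subst nn_integral_add) (auto simp: Q_def)
        also have "\<dots> = (\<integral>\<^sup>+y. emeasure (\<kappa> y) UNIV * indicator B y \<partial>distr M N \<pi>)"
        proof (rule nn_integral_cong)
          fix y
          have "emeasure (\<kappa> y) A + emeasure (\<kappa> y) (UNIV - A) = emeasure (\<kappa> y) UNIV"
            using A sets_\<kappa> by (subst plus_emeasure) auto
          then show "emeasure (\<kappa> y) A * indicator B y + emeasure (\<kappa> y) (UNIV - A) * indicator B y =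
              emeasure (\<kappa> y) UNIV * indicator B y"
            by (metis distrib_right)
        qed
        also have "\<dots> = emeasure M (UNIV \<inter> \<pi> -` B)"
          using Q_\<A>[OF \<A>.top] B by (auto simp: Q_def)
        also have "\<dots> = emeasure M (A \<inter> \<pi> -` B) + emeasure M ((UNIV - A) \<inter> \<pi> -` B)"
          using pre[OF A B] pre[OF borel_comp[OF A] B]
          by (subst plus_emeasure) (auto intro!: arg_cong[of _ _ "emeasure M"] simp: Compl_eq_Diff_UNIV)
        finally show ?thesis by simp
      qed
      then show ?case by (simp add: Q_def)
    next
      case (union A)
      then have A: "A i \<in> sets borel" and [measurable]: "(\<lambda>y. emeasure (\<kappa> y) (A i)) \<in> borel_measurable N" for i
        using sig by (auto simp: Q_def)
      have eq: "emeasure (\<kappa> y) (\<Union>i. A i) = (\<Sum>i. emeasure (\<kappa> y) (A i))" for y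
        using union(1) A sets_\<kappa> by (intro suminf_emeasure[symmetric]) auto
      have "(\<integral>\<^sup>+y. (\<Sum>i. emeasure (\<kappa> y) (A i)) * indicator B y \<partial>distr M N \<pi>) = emeasure M ((\<Union>i. A i) \<inter> \<pi> -` B)"
        if B[measurable]: "B \<in> sets N" for B
      proof -
        have "(\<integral>\<^sup>+y. (\<Sum>i. emeasure (\<kappa> y) (A i)) * indicator B y \<partial>distr M N \<pi>) =
            (\<integral>\<^sup>+y. (\<Sum>i. emeasure (\<kappa> y) (A i) * indicator B y) \<partial>distr M N \<pi>)"
          by simp
        also have "\<dots> = (\<Sum>i. \<integral>\<^sup>+y. emeasure (\<kappa> y) (A i) * indicator B y \<partial>distr M N \<pi>)"
          by (intro nn_integral_suminf) measurable
        also have "\<dots> = (\<Sum>i. emeasure M (A i \<inter> \<pi> -` B))"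
          using union B by (simp add: Q_def)
        also have "\<dots> = emeasure M (\<Union>i. A i \<inter> \<pi> -` B)"
          using union(1) pre[OF A B] by (intro suminf_emeasure) (auto simp: disjoint_family_on_def)
        finally show ?thesis by simp
      qed
      then show ?case unfolding Q_def eq by simp
    qed
  qed
  show thesis
  proof (rule that[of \<kappa>])
    show "AE y in distr M N \<pi>. emeasure (\<kappa> y) UNIV = 1"
      using AE_G by eventually_elim (simp add: one)
  qed (use sets_\<kappa> one Q in \<open>auto simp: Q_def indicator_def\<close>)
qed

section \<open>Concentration on fibres and conclusion\<close>

theorem theorem1:
  fixes \<pi> :: "'a::metric_space \<Rightarrow> 'b::metric_space"
    and \<mu> :: "'a measure"
    and \<nu> :: "'b measure"
  assumes "locally_compact_space (euclidean :: 'a topology)"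
    and "separable_space (euclidean :: 'a topology)"
    and "locally_compact_space (euclidean :: 'b topology)"
    and "separable_space (euclidean :: 'b topology)"
    and "\<pi> \<in> borel \<rightarrow>\<^sub>M borel"
    and "\<mu> \<in> finite_radon_measures"
    and "\<nu> = distr \<mu> borel \<pi>"
  shows "\<nu> \<in> finite_radon_measures \<and>
    (\<exists>\<mu>' :: 'b \<Rightarrow> 'a measure.
      (\<forall>y. \<mu>' y \<in> finite_radon_measures) \<and>
      borel_measure_map \<mu>' \<and>
      (AE y in \<nu>. \<mu>' y \<in> space (prob_algebra borel)) \<and>
      (\<forall>A\<in>sets borel. emeasure \<mu> A = (\<integral>\<^sup>+ y. emeasure (\<mu>' y) A \<partial>\<nu>)) \<and>
      (AE y in \<nu>. concentrated_on (\<mu>' y) (\<pi> -` {y})))"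
proof -
  have \<mu>: "sets \<mu> = sets borel" "finite_measure \<mu>"
    using assms(6) by (auto simp: finite_radon_measures_def)
  have \<pi>[measurable]: "\<pi> \<in> \<mu> \<rightarrow>\<^sub>M borel"
    using assms(5) \<mu>(1) by (simp cong: measurable_cong_sets)
  have fin_\<nu>: "finite_measure \<nu>"
    unfolding assms(7) using \<mu>(2) \<pi> by (rule finite_measure.finite_measure_distr)
  interpret \<nu>: finite_measure \<nu> by fact
  have sets_\<nu>[measurable_cong]: "sets \<nu> = sets borel" by (simp add: assms(7))
  obtain \<kappa> :: "'b \<Rightarrow> 'a measure"
    where \<kappa>: "\<And>y. sets (\<kappa> y) = sets borel" "\<And>y. emeasure (\<kappa> y) UNIV \<le> 1"
      "AE y in \<nu>. emeasure (\<kappa> y) UNIV = 1"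
      "\<And>A. A \<in> sets borel \<Longrightarrow> (\<lambda>y. emeasure (\<kappa> y) A) \<in> borel_measurable borel"
      "\<And>A B. A \<in> sets borel \<Longrightarrow> B \<in> sets borel \<Longrightarrow>
        (\<integral>\<^sup>+y. emeasure (\<kappa> y) A * indicator B y \<partial>\<nu>) = emeasure \<mu> (A \<inter> \<pi> -` B)"
    by (rule disintegration_kernel[OF assms(1,2) \<mu> \<pi>, folded assms(7)]) (rule that)
  have space_\<kappa>: "space (\<kappa> y) = UNIV" for y
    using sets_eq_imp_space_eq[OF \<kappa>(1)] by simp
  have "finite_measure (\<kappa> y)" for y
    using \<kappa>(2)[of y] by (intro finite_measureI) (auto simp: space_\<kappa> top_unique)
  then have "\<forall>y. \<kappa> y \<in> finite_radon_measures"
    using finite_borel_measure_radon[OF assms(1,2) \<kappa>(1)] by blast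
  moreover have "borel_measure_map \<kappa>"
    using \<kappa>(4) by (simp add: borel_measure_map_def)
  moreover have "AE y in \<nu>. \<kappa> y \<in> space (prob_algebra borel)"
    using \<kappa>(3) by eventually_elim (auto simp: space_prob_algebra \<kappa>(1) space_\<kappa> intro!: prob_spaceI)
  moreover have "emeasure \<mu> A = (\<integral>\<^sup>+ y. emeasure (\<kappa> y) A \<partial>\<nu>)" if "A \<in> sets borel" for A
    using \<kappa>(5)[OF that, of UNIV] by simp
  moreover have "AE y in \<nu>. concentrated_on (\<kappa> y) (\<pi> -` {y})"
  proof -
    obtain \<V> :: "'b set set" where \<V>: "countable \<V>" "topological_basis \<V>"
      using separable_metric_countable_basis[OF assms(4)] by metis
    have V_borel: "V \<in> sets borel" if "V \<in> \<V>" for V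
      using topological_basis_open[OF \<V>(2) that] by simp
    have pre: "\<pi> -` V \<in> sets borel" if "V \<in> sets borel" for V
      using measurable_sets[OF assms(5) that] by simp
    \<comment> \<open>The preimages of \<open>V\<close> and of its complement are disjoint, so the
      mass that \<open>\<kappa> y\<close> gives to the preimage of \<open>V\<close> integrates to 0
      over all y outside \<open>V\<close>. Countability of the basis allows one null set for all
      \<open>V\<close>.\<close>
    have "AE y in \<nu>. \<forall>V\<in>\<V>. y \<notin> V \<longrightarrow> emeasure (\<kappa> y) (\<pi> -` V) = 0"
    proof (rule AE_ball_countable'[OF _ \<V>(1)])
      fix V assume "V \<in> \<V>"
      then have V[measurable]: "V \<in> sets borel" by (rule V_borel)
      have [measurable]: "(\<lambda>y. emeasure (\<kappa> y) (\<pi> -` V)) \<in> borel_measurable borel"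
        by (intro \<kappa>(4) pre V)
      have "\<pi> -` V \<inter> \<pi> -` (- V) = {}" by auto
      then have "(\<integral>\<^sup>+y. emeasure (\<kappa> y) (\<pi> -` V) * indicator (- V) y \<partial>\<nu>) = 0"
        using \<kappa>(5)[OF pre[OF V] borel_comp[OF V]] by simp
      then have "AE y in \<nu>. emeasure (\<kappa> y) (\<pi> -` V) * indicator (- V) y = 0"
        by (subst (asm) nn_integral_0_iff_AE) measurable
      then show "AE y in \<nu>. y \<notin> V \<longrightarrow> emeasure (\<kappa> y) (\<pi> -` V) = 0"
        by eventually_elim auto
    qed
    then show ?thesis
    proof eventually_elim
      case (elim y)
      \<comment> \<open>The complement of a point is open, hence the union of the basic sets
        avoiding y; its preimage is thus a countable union of null sets of
        \<open>\<kappa> y\<close>.\<close>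
      have "\<exists>V\<in>{V \<in> \<V>. y \<notin> V}. z \<in> V" if "z \<noteq> y" for z
        using topological_basisE[OF \<V>(2), of "- {y}" z] that by (auto simp: subset_Compl_singleton)
      then have "UNIV - \<pi> -` {y} = (\<Union>V\<in>{V \<in> \<V>. y \<notin> V}. \<pi> -` V)"
        by blast
      moreover have "(\<Union>V\<in>{V \<in> \<V>. y \<notin> V}. \<pi> -` V) \<in> null_sets (\<kappa> y)"
        using elim \<V>(1) pre[OF V_borel] by (intro null_sets_UN') (auto simp: null_sets_def \<kappa>(1))
      ultimately show ?case by (simp add: concentrated_on_def space_\<kappa>)
    qed
  qed
  moreover have "\<nu> \<in> finite_radon_measures"
    using finite_borel_measure_radon[OF assms(3,4) sets_\<nu> fin_\<nu>] .
  ultimately show ?thesis by blast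
qed

end
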